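(* Fix $t>0$, $x_0\in\mathbb{R}$ and $\sigma>0$. For $\mu\in\mathbb{R}$ let $\gamma_{\mu}$ denote the Gaussian probability measure on $\mathbb{R}$ with mean $x_0+\mu t$ and variance $\sigma^2 t$. For $n\ge1$ define $T^*_n:\mathbb{R}^n\to\mathbb{R}$ by $$T^*_n(z_1,\dots,z_n)=\frac{\sum_{k=1}^n (z_k-x_0)}{nt}.$$ Then for every $\mu\in\mathbb{R}$, $$\gamma_{\mu}^{\infty}\Big(\Big\{(z_k)_{k\in\mathbb{N}}\in\mathbb{R}^{\infty}:\ \lim_{n\to\infty}T^*_n(z_1,\dots,z_n)=\mu\Big\}\Big)=1,$$ that is, $(T^*_n)_{n\ge1}$ is a consistent estimator (in the sense of everywhere convergence) of the drift parameter $\mu$ for the family $(\gamma_\mu^\infty)_{\mu\in\mathbb{R}}$.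
   Context: $\mathbb{N}=\{1,2,\dots\}$, and $\mathbb{R}^{\infty}=\mathbb{R}^{\mathbb{N}}$ is the space of real sequences with its Borel (product) $\sigma$-algebra. For a Borel probability measure $\gamma$ on $\mathbb{R}$, $\gamma^{\infty}$ is the infinite product measure on $\mathbb{R}^{\infty}$. The measure $\gamma_{\mu}$ is the law at time $t$ of the Wiener process with drift $X_t=x_0+\mu t+\sigma W_t$. Given a family $(\gamma_\theta)_{\theta\in\mathbb{R}}$ of Borel probability measures on $\mathbb{R}$, a sequence of Borel measurable functions $T_n:\mathbb{R}^n\to\mathbb{R}$ is called a consistent estimator of $\theta$ (in the sense of everywhere convergence) for $(\gamma_\theta^\infty)_{\theta\in\mathbb{R}}$ if $\gamma_\theta^\infty(\{(x_k)_{k\in\mathbb{N}}:\lim_{n\to\infty}T_n(x_1,\dots,x_n)=\theta\})=1$ for each $\theta\in\mathbb{R}$. *)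

theory Defs
  imports "HOL-Probability.Probability"
begin

text \<open>
  The library's \<^const>\<open>normal_density\<close> takes the standard deviation, whereas the second
  argument here is the variance; it is meant for a positive variance only.
\<close>
definition gaussian_measure :: "real \<Rightarrow> real \<Rightarrow> real measure" where
  "gaussian_measure m v = density lborel (\<lambda>x. ennreal (normal_density m (sqrt v) x))"

text \<open>
  Real sequences are indexed by the positive integers, that is, they are functions that are
  extensional on \<open>{1..}\<close>; likewise the points of \<open>n\<close>-dimensional space are functions that are
  extensional on \<open>{1..n}\<close>.
\<close>
definition infinite_power :: "real measure \<Rightarrow> (nat \<Rightarrow> real) measure" where
  "infinite_power M = Pi\<^sub>M {1..} (\<lambda>_. M)"

text \<open>
  In the last clause a set that is not measurable would get measure 0 from \<^const>\<open>measure\<close>,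
  so measurability of the set is part of the condition.
\<close>
definition consistent_estimator ::
    "(real \<Rightarrow> real measure) \<Rightarrow> (nat \<Rightarrow> (nat \<Rightarrow> real) \<Rightarrow> real) \<Rightarrow> bool" where
  "consistent_estimator \<gamma> T \<longleftrightarrow>
     (\<forall>\<theta>. prob_space (\<gamma> \<theta>) \<and> sets (\<gamma> \<theta>) = sets borel) \<and>
     (\<forall>n\<ge>1. T n \<in> borel_measurable (Pi\<^sub>M {1..n} (\<lambda>_. borel))) \<and>
     (\<forall>\<theta>. measure (infinite_power (\<gamma> \<theta>))
            {x \<in> space (infinite_power (\<gamma> \<theta>)).
               (\<lambda>n. T n (restrict x {1..n})) \<longlonglongrightarrow> \<theta>} = 1)"

definition drift_estimator :: "real \<Rightarrow> real \<Rightarrow> nat \<Rightarrow> (nat \<Rightarrow> real) \<Rightarrow> real" where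
  "drift_estimator t x0 n z = (\<Sum>k=1..n. (z k - x0)) / (real n * t)"

end

theory Submission
  imports Defs
begin

text \<open>
  The estimator at time \<open>n\<close> is an affine function of a sum of \<open>n\<close> independent normal variables, so
  it is itself normal, with mean \<open>\<mu>\<close> and variance \<open>\<sigma>\<^sup>2 / (n * t)\<close>. Its fourth central moment is
  therefore \<open>3 * \<sigma> ^ 4 / (n * t)\<^sup>2\<close>, which is summable in \<open>n\<close>. Hence the sum of the fourth powers of
  the errors has finite expectation, is almost surely finite, and the errors tend to 0.
\<close>

lemma normal_distributed_fourth_moment:
  assumes D: "distributed M lborel X (normal_density m s)" and s: "0 < s"
  shows "(\<integral>\<^sup>+x. ennreal ((X x - m) ^ 4) \<partial>M) = ennreal (3 * s ^ 4)"
proof -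
  have "(\<integral>\<^sup>+x. ennreal ((X x - m) ^ 4) \<partial>M) =
      (\<integral>\<^sup>+x. ennreal (normal_density m s x) * ennreal ((x - m) ^ 4) \<partial>lborel)"
    by (rule distributed_nn_integral[OF D, symmetric]) simp
  \<comment> \<open>Writing 4 as \<open>2 * 2\<close> matches the even moment formula with k = 2,
    which gives 4! / ((2 / s^2)^2 * 2!) = 3 * s^4.\<close>
  also have "\<dots> = (\<integral>\<^sup>+x. ennreal (normal_density m s x * (x - m) ^ (2 * 2)) \<partial>lborel)"
    by (simp add: ennreal_mult')
  also have "\<dots> = ennreal (\<integral>x. normal_density m s x * (x - m) ^ (2 * 2) \<partial>lborel)"
    using normal_moment_even[OF s, of m 2]
    by (intro nn_integral_eq_integral) (auto simp: has_bochner_integral_iff normal_density_nonneg)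
  also have "(\<integral>x. normal_density m s x * (x - m) ^ (2 * 2) \<partial>lborel) = 3 * s ^ 4"
    using s by (subst integral_normal_moment_even) (simp_all add: fact_numeral field_simps)
  finally show ?thesis .
qed

text \<open>Sum and integral are interchanged for nonnegative terms, whatever the joint law of the
  \<open>X n\<close>; successive estimators share observations and are dependent. Second moments
  would not do in the application: there \<open>s n ^ 2\<close> is of order 1/n, whose series
  diverges.\<close>

lemma AE_normal_tendsto_mean:
  fixes X :: "nat \<Rightarrow> 'a \<Rightarrow> real"
  assumes D: "\<And>n. distributed M lborel (X n) (normal_density m (s n))"
    and s: "\<And>n. 0 < s n" and summ: "summable (\<lambda>n. s n ^ 4)"
  shows "AE x in M. (\<lambda>n. X n x) \<longlonglongrightarrow> m"
proof -
  have [measurable]: "X n \<in> borel_measurable M" for n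
    using distributed_measurable[OF D[of n]] by simp
  have "(\<integral>\<^sup>+x. (\<Sum>n. ennreal ((X n x - m) ^ 4)) \<partial>M) = (\<Sum>n. ennreal (3 * s n ^ 4))"
    by (subst nn_integral_suminf) (auto simp: normal_distributed_fourth_moment[OF D s])
  also have "\<dots> \<noteq> \<infinity>"
    unfolding infinity_ennreal_def
    using summ s by (intro ennreal_suminf_neq_top summable_mult) (auto intro: less_imp_le)
  finally have "AE x in M. (\<Sum>n. ennreal ((X n x - m) ^ 4)) \<noteq> \<infinity>"
    by (intro nn_integral_PInf_AE) auto
  then show ?thesis
  proof eventually_elim
    case (elim x)
    then have "summable (\<lambda>n. (X n x - m) ^ 4)"
      by (intro summable_suminf_not_top) auto
    then have "(\<lambda>n. (X n x - m) ^ 4) \<longlonglongrightarrow> 0"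
      by (rule summable_LIMSEQ_zero)
    then show ?case
      by (simp add: power_tendsto_0_iff LIM_zero_iff)
  qed
qed

text \<open>Independence amounts to the joint law being the product of the marginal laws. The joint
  law is the image under restriction to \<open>J\<close>, a reindexing along the identity, and each
  marginal is a factor \<open>M i\<close>; both sides are thus \<open>PiM J M\<close>.\<close>

lemma indep_vars_PiM_coordinates:
  assumes "\<And>i. i \<in> I \<Longrightarrow> prob_space (M i)" and "J \<subseteq> I" and "J \<noteq> {}"
  shows "prob_space.indep_vars (PiM I M) M (\<lambda>i x. x i) J"
proof -
  interpret prob_space "PiM I M"
    by (rule prob_space_PiM) fact
  have "distr (PiM I M) (PiM J M) (\<lambda>x. \<lambda>i\<in>J. x i) = PiM J M"
    using distr_PiM_reindex[of I M "\<lambda>i. i" J] assms by auto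
  also have "\<dots> = (\<Pi>\<^sub>M i\<in>J. distr (PiM I M) (M i) (\<lambda>x. x i))"
    using assms by (intro PiM_cong refl) (auto simp: distr_PiM_component)
  finally show ?thesis
    using assms by (subst indep_vars_iff_distr_eq_PiM') auto
qed

lemma prob_space_gaussian_measure: "0 < v \<Longrightarrow> prob_space (gaussian_measure m v)"
  unfolding gaussian_measure_def by (intro prob_space_normal_density) simp

lemma sets_gaussian_measure [measurable_cong]: "sets (gaussian_measure m v) = sets borel"
  by (simp add: gaussian_measure_def)

lemma drift_estimator_measurable:
  "drift_estimator t x0 n \<in> borel_measurable (Pi\<^sub>M {1..n} (\<lambda>_. borel))"
  unfolding drift_estimator_def by measurable

lemma drift_estimator_restrict:
  "drift_estimator t x0 n (restrict z {1..n}) = drift_estimator t x0 n z"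
  by (simp add: drift_estimator_def)

context
  fixes m v :: real
  assumes v: "0 < v"
begin

interpretation P: prob_space "infinite_power (gaussian_measure m v)"
  unfolding infinite_power_def by (intro prob_space_PiM prob_space_gaussian_measure v)

text \<open>Means and variances of independent normal variables add up. The empty sum is the
  constant 0 and has no density, hence \<open>0 < n\<close>.\<close>

lemma distributed_sum_infinite_power_gaussian:
  assumes "0 < n"
  shows "distributed (infinite_power (gaussian_measure m v)) lborel (\<lambda>z. \<Sum>k=1..n. z k)
           (normal_density (real n * m) (sqrt (real n * v)))"
proof -
  let ?M = "gaussian_measure m v"
  have "P.indep_vars (\<lambda>_. ?M) (\<lambda>k z. z k) {1..n}"
    unfolding infinite_power_def
    using assms v by (intro indep_vars_PiM_coordinates prob_space_gaussian_measure) auto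
  \<comment> \<open>Composing with the identity replaces the target \<open>?M\<close> by
    \<open>borel\<close>, the form that \<open>P.sum_indep_normal\<close> expects.\<close>
  then have "P.indep_vars (\<lambda>_. borel) (\<lambda>k z. z k) {1..n}"
    by (rule P.indep_vars_compose2[where Y = "\<lambda>_ x. x"]) measurable
  moreover have "distributed (infinite_power ?M) lborel (\<lambda>z. z k) (normal_density m (sqrt v))"
    if "k \<in> {1..n}" for k
  proof -
    \<comment> \<open>An image measure depends on its target only through the sigma-algebra.\<close>
    have "distr (infinite_power ?M) lborel (\<lambda>z. z k) = distr (infinite_power ?M) ?M (\<lambda>z. z k)"
      by (intro distr_cong) (simp_all add: sets_gaussian_measure)
    also have "\<dots> = ?M"
      unfolding infinite_power_def
      using that v by (intro distr_PiM_component prob_space_gaussian_measure) auto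
    finally have "distr (infinite_power ?M) lborel (\<lambda>z. z k) = density lborel (normal_density m (sqrt v))"
      by (simp add: gaussian_measure_def)
    moreover have "(\<lambda>z. z k) \<in> borel_measurable (infinite_power ?M)"
      unfolding infinite_power_def using that by simp
    ultimately show ?thesis
      by (simp add: distributed_def)
  qed
  ultimately show ?thesis
    using P.sum_indep_normal[of "{1..n}" "\<lambda>k z. z k" "\<lambda>_. sqrt v" "\<lambda>_. m"] assms v by simp
qed

lemma AE_drift_estimator_tendsto:
  assumes t: "0 < t"
  shows "AE z in infinite_power (gaussian_measure m v).
           (\<lambda>n. drift_estimator t x0 n z) \<longlonglongrightarrow> (m - x0) / t"
proof -
  \<comment> \<open>The standard deviation of the estimator from \<open>Suc n\<close> observations.
    The shift avoids n = 0, where the estimator is 0 / 0 = 0 and has no density.\<close>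
  define s where "s n = sqrt (real (Suc n) * v) / (real (Suc n) * t)" for n
  have "distributed (infinite_power (gaussian_measure m v)) lborel (drift_estimator t x0 (Suc n))
          (normal_density ((m - x0) / t) (s n))" for n
  proof -
    let ?a = "1 / (real (Suc n) * t)"
    \<comment> \<open>The offset collects the \<open>Suc n\<close> subtractions of
      \<open>x0\<close>, each scaled by \<open>?a\<close>.\<close>
    have "distributed (infinite_power (gaussian_measure m v)) lborel
            (\<lambda>z. - x0 / t + ?a * (\<Sum>k=1..Suc n. z k))
            (normal_density (- x0 / t + ?a * (real (Suc n) * m)) (\<bar>?a\<bar> * sqrt (real (Suc n) * v)))"
      using t v by (intro P.normal_density_affine distributed_sum_infinite_power_gaussian) auto
    also have "(\<lambda>z. - x0 / t + ?a * (\<Sum>k=1..Suc n. z k)) = drift_estimator t x0 (Suc n)"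
      using t by (simp add: fun_eq_iff drift_estimator_def sum_subtractf diff_divide_distrib
          del: of_nat_Suc sum.cl_ivl_Suc)
    also have "- x0 / t + ?a * (real (Suc n) * m) = (m - x0) / t"
      using t by (simp add: field_simps del: of_nat_Suc)
    also have "\<bar>?a\<bar> * sqrt (real (Suc n) * v) = s n"
      using t by (simp add: s_def del: of_nat_Suc)
    finally show ?thesis .
  qed
  moreover have "0 < s n" for n
    using t v by (simp add: s_def)
  moreover have "summable (\<lambda>n. s n ^ 4)"
  proof -
    have "s n ^ 4 = (v / t\<^sup>2)\<^sup>2 * (1 / real (Suc n) ^ 2)" for n
    proof -
      have "s n ^ 4 = ((s n)\<^sup>2)\<^sup>2"
        by simp
      also have "(s n)\<^sup>2 = v / t\<^sup>2 * (1 / real (Suc n))"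
        using v by (simp add: s_def power_divide power_mult_distrib power2_eq_square del: of_nat_Suc)
      finally show ?thesis
        by (simp add: power_mult_distrib power_divide del: of_nat_Suc)
    qed
    moreover have "summable (\<lambda>n. 1 / real (Suc n) ^ 2)"
      \<comment> \<open>Dropping the term at index 0 does not affect convergence.\<close>
      using inverse_power_summable[of 2, where 'a = real]
      by (subst summable_Suc_iff) (simp add: inverse_eq_divide)
    ultimately show ?thesis
      by (simp only: summable_mult)
  qed
  ultimately have "AE z in infinite_power (gaussian_measure m v).
      (\<lambda>n. drift_estimator t x0 (Suc n) z) \<longlonglongrightarrow> (m - x0) / t"
    by (rule AE_normal_tendsto_mean)
  then show ?thesis
    by eventually_elim (rule LIMSEQ_imp_Suc)
qed

lemma measure_drift_estimator_tendsto:
  assumes "0 < t"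
  shows "measure (infinite_power (gaussian_measure m v))
           {z \<in> space (infinite_power (gaussian_measure m v)).
              (\<lambda>n. drift_estimator t x0 n (restrict z {1..n})) \<longlonglongrightarrow> (m - x0) / t} = 1"
proof -
  have [measurable]: "drift_estimator t x0 n \<in> borel_measurable (infinite_power (gaussian_measure m v))"
    for n
    unfolding drift_estimator_def infinite_power_def by measurable
  show ?thesis
    unfolding drift_estimator_restrict
    \<comment> \<open>Passing from almost sure convergence to probability 1 requires the convergence
      set to be an event, which follows from measurability of each estimator.\<close>
    by (subst P.prob_Collect_eq_1) (measurable, rule AE_drift_estimator_tendsto[OF assms])
qed

end

theorem theorem3p2p1:
  fixes t x0 \<sigma> :: real and \<gamma> :: "real \<Rightarrow> real measure"
  assumes "t > 0" and "\<sigma> > 0"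
    and "\<And>\<mu>. \<gamma> \<mu> = gaussian_measure (x0 + \<mu> * t) (\<sigma>\<^sup>2 * t)"
  shows "(\<forall>\<mu>. measure (infinite_power (\<gamma> \<mu>))
            {z \<in> space (infinite_power (\<gamma> \<mu>)).
               (\<lambda>n. drift_estimator t x0 n (restrict z {1..n})) \<longlonglongrightarrow> \<mu>} = 1)
         \<and> consistent_estimator \<gamma> (drift_estimator t x0)"
proof -
  have v: "0 < \<sigma>\<^sup>2 * t"
    using assms by simp
  have "measure (infinite_power (\<gamma> \<mu>))
      {z \<in> space (infinite_power (\<gamma> \<mu>)).
         (\<lambda>n. drift_estimator t x0 n (restrict z {1..n})) \<longlonglongrightarrow> \<mu>} = 1" for \<mu>
    \<comment> \<open>For m = x0 + \<mu> * t the limit (m - x0) / t is \<mu>.\<close>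
    using measure_drift_estimator_tendsto[OF v \<open>t > 0\<close>, of "x0 + \<mu> * t" x0] \<open>t > 0\<close>
    by (simp add: assms(3))
  moreover have "prob_space (\<gamma> \<mu>)" "sets (\<gamma> \<mu>) = sets borel" for \<mu>
    using v by (simp_all add: assms(3) prob_space_gaussian_measure sets_gaussian_measure)
  ultimately show ?thesis
    unfolding consistent_estimator_def using drift_estimator_measurable by blast
qed

end
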